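(* Suppose that $\mathbf{v},\mathbf{w},\mathbf{x} \in \mathbb{R}^n$ are vectors. Then \begin{align*} & \sum_{j=1}^n \sqrt{\big(v_j^2\|\mathbf{v} \odot \mathbf{w}\|^2 + w_j^2\|\mathbf{v}^2\|^2 - v_j^4 w_j^2\big)\big(x_j^2\|\mathbf{x} \odot \mathbf{w}\|^2 + w_j^2\|\mathbf{x}^2\|^2 - x_j^4 w_j^2\big)} \\ & + \sum_{i=1}^n v_ix_i\sqrt{\sum_{j=1,j\neq i}^n\ \sum_{k=1,k\neq i,k \neq j}^n v_j^2 w_k^2}\ \sqrt{\sum_{j=1,j\neq i}^n\ \sum_{k=1,k\neq i,k \neq j}^n x_j^2 w_k^2} \\ & \leq \|\mathbf{v}\|^2\|\mathbf{w}\|^2\|\mathbf{x}\|^2 + \|\mathbf{v} \odot \mathbf{w} \odot \mathbf{x}\|^2 - \langle \mathbf{v} \odot \mathbf{w},\ \mathbf{x} \odot \mathbf{w}\rangle\langle \mathbf{v},\mathbf{x}\rangle. \end{align*}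
   Context: $v_j,w_j,x_j$ are the entries of $\mathbf{v},\mathbf{w},\mathbf{x}$. $\odot$ denotes the Hadamard (entrywise) product, and $\mathbf{v}^2=(v_1^2,\ldots,v_n^2)$ is the entrywise square (similarly for $\mathbf{x}^2$). $\langle\cdot,\cdot\rangle$ and $\|\cdot\|$ are the usual dot product and Euclidean norm on $\mathbb{R}^n$. *)

theory Defs
  imports "HOL-Analysis.Analysis"
begin

(* In HOL-Analysis the product of two vectors of the same finite Cartesian power is taken
   entrywise, i.e. it is the Hadamard product, and v\<^sup>2 is the entrywise square. *)

abbreviation hadamard :: "real ^ 'n \<Rightarrow> real ^ 'n \<Rightarrow> real ^ 'n"  (infixl "\<odot>" 70)
  where "v \<odot> w \<equiv> v * w"

lemma hadamard_component: "(v \<odot> w) $ i = v $ i * w $ i"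
  by simp

lemma entrywise_square_component: "((v :: real ^ 'n)\<^sup>2) $ i = (v $ i)\<^sup>2"
  by (simp add: power2_eq_square)

end

theory Submission
  imports Defs
begin

text \<open>
  The inequality is a single application of the Cauchy--Schwarz inequality.  Move the term
  \<open>\<langle>v \<odot> w, x \<odot> w\<rangle>\<langle>v, x\<rangle> - \<parallel>v \<odot> w \<odot> x\<parallel>\<^sup>2\<close> to the left-hand side; it equals
  \<open>\<Sum>i \<noteq> k. (v\<^sub>i v\<^sub>k w\<^sub>k) (x\<^sub>i x\<^sub>k w\<^sub>k)\<close>, an inner product of two matrices.
  The two remaining sums on the left-hand side are inner products as well, each summand being a
  product of a number depending on \<open>v, w\<close> and the same number for \<open>x, w\<close>.
  Hence the whole left-hand side is \<open>\<langle>T(v), T(x)\<rangle>\<close> for the block vector \<open>T\<close> (called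
  \<open>block_vec w\<close> below) that collects these three blocks, which is \<open>block_vec_inner\<close>.

  The expressions under the square roots are precisely such that
  \<open>\<parallel>T(v)\<parallel>\<^sup>2 = \<parallel>w\<parallel>\<^sup>2 \<parallel>v\<parallel>\<^sup>4\<close>, the squared norm of the tensor \<open>v \<otimes> v \<otimes> w\<close>.  The blocks of \<open>T\<close>
  split the entries \<open>v\<^sub>a v\<^sub>b w\<^sub>c\<close> of this tensor by the coincidences among \<open>a, b, c\<close>: the first
  block has those with \<open>b = c\<close> or \<open>a = b\<close> (its \<open>j\<close>-th entry is the norm of those where the
  index outside the equal pair is \<open>j\<close>), the second has those with
  \<open>a, b, c\<close> distinct (for each \<open>a\<close> their norm, with the sign of \<open>v\<^sub>a\<close>), and the third has those with \<open>a = c \<noteq> b\<close>.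
  This is \<open>block_vec_norm\<close>, and Cauchy--Schwarz gives
  \<open>\<langle>T(v), T(x)\<rangle> \<le> \<parallel>T(v)\<parallel> \<parallel>T(x)\<parallel> = \<parallel>w\<parallel>\<^sup>2 \<parallel>v\<parallel>\<^sup>2 \<parallel>x\<parallel>\<^sup>2\<close>.
\<close>

text \<open>
  The squared norm of the entries \<open>v\<^sub>j v\<^sub>k w\<^sub>k\<close> (all \<open>k\<close>) and \<open>v\<^sub>k v\<^sub>k w\<^sub>j\<close> (\<open>k \<noteq> j\<close>); the
  subtracted term removes the second copy of \<open>v\<^sub>j v\<^sub>j w\<^sub>j\<close>.
\<close>

definition row_weight :: "real ^ 'n \<Rightarrow> real ^ 'n \<Rightarrow> 'n \<Rightarrow> real" where
  "row_weight w v j =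
     (v $ j)\<^sup>2 * (norm (v \<odot> w))\<^sup>2 + (w $ j)\<^sup>2 * (norm (v\<^sup>2))\<^sup>2 - (v $ j) ^ 4 * (w $ j)\<^sup>2"

definition distinct_weight :: "real ^ 'n \<Rightarrow> real ^ 'n \<Rightarrow> 'n \<Rightarrow> real" where
  "distinct_weight w v i = (\<Sum>j\<in>UNIV - {i}. \<Sum>k\<in>UNIV - {i, j}. (v $ j)\<^sup>2 * (w $ k)\<^sup>2)"

definition block_vec ::
  "real ^ 'n \<Rightarrow> real ^ 'n \<Rightarrow> (real ^ 'n) \<times> (real ^ 'n) \<times> (real ^ 'n ^ 'n)" where
  "block_vec w v =
     ((\<chi> j. sqrt (row_weight w v j)),
      (\<chi> i. v $ i * sqrt (distinct_weight w v i)),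
      (\<chi> i k. if k = i then 0 else v $ i * (v $ k * w $ k)))"

lemma norm_vec_power2: "(norm (v :: real ^ 'n))\<^sup>2 = (\<Sum>i\<in>UNIV. (v $ i)\<^sup>2)"
  unfolding power2_norm_eq_inner by (simp add: inner_vec_def power2_eq_square)

lemma sum_if_ne:
  fixes f :: "'n::finite \<Rightarrow> real"
  shows "(\<Sum>k\<in>UNIV. if k = i then 0 else f k) = (\<Sum>k\<in>UNIV. f k) - f i"
proof -
  have "(\<Sum>k\<in>UNIV. if k = i then 0 else f k) = (\<Sum>k\<in>UNIV. f k - (if k = i then f k else 0))"
    by (intro sum.cong) auto
  then show ?thesis by (simp add: sum_subtractf)
qed

text \<open>
  The subtracted term is the \<open>j\<close>-th summand of \<open>w\<^sub>j\<^sup>2 \<parallel>v\<^sup>2\<parallel>\<^sup>2\<close>.  Non-negativity is what makes the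
  square of \<open>sqrt (row_weight w v j)\<close> equal to the weight itself when \<open>\<parallel>T(v)\<parallel>\<close> is computed.
\<close>

lemma row_weight_nonneg: "0 \<le> row_weight w v j"
proof -
  have "((v\<^sup>2) $ j)\<^sup>2 \<le> (norm (v\<^sup>2))\<^sup>2"
    by (metis abs_ge_zero component_le_norm_cart power2_abs power_mono)
  then have "(v $ j) ^ 4 \<le> (norm (v\<^sup>2))\<^sup>2"
    by (simp only: entrywise_square_component flip: power_mult) simp
  then have "(v $ j) ^ 4 * (w $ j)\<^sup>2 \<le> (norm (v\<^sup>2))\<^sup>2 * (w $ j)\<^sup>2"
    by (rule mult_right_mono) simp
  moreover have "0 \<le> (v $ j)\<^sup>2 * (norm (v \<odot> w))\<^sup>2" by simp
  ultimately show ?thesis unfolding row_weight_def by (simp only: mult.commute)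
qed

lemma distinct_weight_nonneg: "0 \<le> distinct_weight w v i"
  unfolding distinct_weight_def by (intro sum_nonneg) simp

text \<open>Inclusion--exclusion over the coincidences among the indices \<open>i, j, k\<close>.\<close>

lemma distinct_weight_eq:
  "distinct_weight w v i =
     ((norm v)\<^sup>2 - (v $ i)\<^sup>2) * ((norm w)\<^sup>2 - (w $ i)\<^sup>2)
     - ((norm (v \<odot> w))\<^sup>2 - (v $ i)\<^sup>2 * (w $ i)\<^sup>2)"
proof -
  have "(\<Sum>k\<in>UNIV - {i, j}. (v $ j)\<^sup>2 * (w $ k)\<^sup>2)
          = (v $ j)\<^sup>2 * ((norm w)\<^sup>2 - (w $ i)\<^sup>2) - (v $ j)\<^sup>2 * (w $ j)\<^sup>2" if "j \<noteq> i" for j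
    using that
    by (simp add: sum_diff norm_vec_power2 algebra_simps flip: sum_distrib_left)
  then have "distinct_weight w v i =
      (\<Sum>j\<in>UNIV - {i}. (v $ j)\<^sup>2 * ((norm w)\<^sup>2 - (w $ i)\<^sup>2) - (v $ j)\<^sup>2 * (w $ j)\<^sup>2)"
    unfolding distinct_weight_def by (intro sum.cong) auto
  also have "\<dots> = (\<Sum>j\<in>UNIV - {i}. (v $ j)\<^sup>2) * ((norm w)\<^sup>2 - (w $ i)\<^sup>2)
                  - (\<Sum>j\<in>UNIV - {i}. (v $ j)\<^sup>2 * (w $ j)\<^sup>2)"
    by (simp only: sum_subtractf sum_distrib_right)
  finally show ?thesis
    by (simp add: sum_diff1 norm_vec_power2 power_mult_distrib)
qed

text \<open>
  The first two blocks give the two sums of square roots directly.  In the third block the sum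
  over all \<open>(i, k)\<close> factors as \<open>\<langle>v \<odot> w, x \<odot> w\<rangle>\<langle>v, x\<rangle>\<close>, and the excluded diagonal
  contributes \<open>\<parallel>v \<odot> w \<odot> x\<parallel>\<^sup>2\<close>.
\<close>

lemma block_vec_inner:
  fixes v w x :: "real ^ 'n"
  shows "block_vec w v \<bullet> block_vec w x =
     (\<Sum>j\<in>UNIV. sqrt (row_weight w v j * row_weight w x j))
     + (\<Sum>i\<in>UNIV. v $ i * x $ i * sqrt (distinct_weight w v i) * sqrt (distinct_weight w x i))
     + (((v \<odot> w) \<bullet> (x \<odot> w)) * (v \<bullet> x) - (norm (v \<odot> w \<odot> x))\<^sup>2)"
proof -
  define P where "P = (v \<odot> w) \<bullet> (x \<odot> w)"
  have P: "(\<Sum>k\<in>UNIV. v $ k * w $ k * (x $ k * w $ k)) = P"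
    by (simp add: P_def inner_vec_def)
  have "(\<Sum>i\<in>UNIV. \<Sum>k\<in>UNIV. (if k = i then 0 else v $ i * (v $ k * w $ k))
            * (if k = i then 0 else x $ i * (x $ k * w $ k)))
        = (\<Sum>i\<in>UNIV. \<Sum>k\<in>UNIV. if k = i then 0
             else v $ i * x $ i * (v $ k * w $ k * (x $ k * w $ k)))"
    by (intro sum.cong) auto
  also have "\<dots> = (\<Sum>i\<in>UNIV. v $ i * x $ i * P - (v $ i * w $ i * x $ i)\<^sup>2)"
    by (simp add: sum_if_ne P flip: sum_distrib_left) (simp add: power2_eq_square mult_ac)
  also have "\<dots> = P * (v \<bullet> x) - (norm (v \<odot> w \<odot> x))\<^sup>2"
    by (simp add: sum_subtractf norm_vec_power2 inner_vec_def mult.commute sum_distrib_left)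
  finally show ?thesis
    unfolding P_def block_vec_def
    by (simp add: inner_vec_def real_sqrt_mult mult_ac)
qed

text \<open>
  Summing each block gives a polynomial in the power sums \<open>N, C, P, Q, R\<close> introduced in the
  proof; the blocks partition the entries of \<open>v \<otimes> v \<otimes> w\<close>, so everything except \<open>N\<^sup>2 C\<close>
  cancels.
\<close>

lemma block_vec_norm:
  fixes v w :: "real ^ 'n"
  shows "norm (block_vec w v) = norm w * (norm v)\<^sup>2"
proof -
  define N C P Q R where "N = (norm v)\<^sup>2" and "C = (norm w)\<^sup>2" and "P = (norm (v \<odot> w))\<^sup>2"
    and "Q = (norm (v\<^sup>2))\<^sup>2" and "R = (norm (v \<odot> w \<odot> v))\<^sup>2"
  have sums: "(\<Sum>i\<in>UNIV. (v $ i)\<^sup>2) = N" "(\<Sum>i\<in>UNIV. (w $ i)\<^sup>2) = C"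
    "(\<Sum>i\<in>UNIV. (v $ i)\<^sup>2 * (w $ i)\<^sup>2) = P" "(\<Sum>i\<in>UNIV. (v $ i) ^ 4) = Q"
    "(\<Sum>i\<in>UNIV. (v $ i) ^ 4 * (w $ i)\<^sup>2) = R"
    unfolding N_def C_def P_def Q_def R_def norm_vec_power2
    by (simp_all only: entrywise_square_component hadamard_component)
       (simp_all add: power_mult_distrib mult_ac flip: power_mult power_add)
  have row: "(\<Sum>j\<in>UNIV. row_weight w v j) = N * P + C * Q - R"
    unfolding row_weight_def P_def[symmetric] Q_def[symmetric]
    by (simp only: sum.distrib sum_subtractf sums flip: sum_distrib_right)
  have "(\<Sum>i\<in>UNIV. (v $ i)\<^sup>2 * distinct_weight w v i)
      = (\<Sum>i\<in>UNIV. (v $ i)\<^sup>2 * (N * C - P) - (v $ i)\<^sup>2 * (w $ i)\<^sup>2 * N - (v $ i) ^ 4 * C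
          + (v $ i) ^ 4 * (w $ i)\<^sup>2 * 2)"
    unfolding distinct_weight_eq N_def[symmetric] C_def[symmetric] P_def[symmetric]
    by (intro sum.cong) (simp_all add: algebra_simps power2_eq_square power4_eq_xxxx)
  also have "\<dots> = N * (N * C - P) - P * N - Q * C + R * 2"
    by (simp only: sum.distrib sum_subtractf sums flip: sum_distrib_right)
  finally have distinct:
    "(\<Sum>i\<in>UNIV. (v $ i)\<^sup>2 * distinct_weight w v i) = N * (N * C - P) - P * N - Q * C + R * 2" .
  have "block_vec w v \<bullet> block_vec w v
      = (\<Sum>j\<in>UNIV. row_weight w v j) + (\<Sum>i\<in>UNIV. (v $ i)\<^sup>2 * distinct_weight w v i)
        + (P * N - R)"
    unfolding block_vec_inner P_def N_def R_def
    by (simp add: row_weight_nonneg distinct_weight_nonneg mult.assoc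
        flip: power2_norm_eq_inner) (simp add: power2_eq_square mult.assoc)
  also have "\<dots> = N\<^sup>2 * C"
    unfolding row distinct by (simp add: algebra_simps power2_eq_square)
  also have "\<dots> = (norm w * (norm v)\<^sup>2)\<^sup>2"
    by (simp add: N_def C_def power_mult_distrib)
  finally show ?thesis
    unfolding norm_eq_sqrt_inner[of "block_vec w v"] by simp
qed

theorem corollary4p2:
  fixes v w x :: "real ^ 'n"
  shows "(\<Sum>j\<in>UNIV. sqrt
            (((v $ j)\<^sup>2 * (norm (v \<odot> w))\<^sup>2 + (w $ j)\<^sup>2 * (norm (v\<^sup>2))\<^sup>2 - (v $ j) ^ 4 * (w $ j)\<^sup>2)
           * ((x $ j)\<^sup>2 * (norm (x \<odot> w))\<^sup>2 + (w $ j)\<^sup>2 * (norm (x\<^sup>2))\<^sup>2 - (x $ j) ^ 4 * (w $ j)\<^sup>2)))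
       + (\<Sum>i\<in>UNIV. v $ i * x $ i
            * sqrt (\<Sum>j\<in>UNIV - {i}. \<Sum>k\<in>UNIV - {i, j}. (v $ j)\<^sup>2 * (w $ k)\<^sup>2)
            * sqrt (\<Sum>j\<in>UNIV - {i}. \<Sum>k\<in>UNIV - {i, j}. (x $ j)\<^sup>2 * (w $ k)\<^sup>2))
       \<le> (norm v)\<^sup>2 * (norm w)\<^sup>2 * (norm x)\<^sup>2 + (norm (v \<odot> w \<odot> x))\<^sup>2
          - ((v \<odot> w) \<bullet> (x \<odot> w)) * (v \<bullet> x)"
proof -
  have "block_vec w v \<bullet> block_vec w x \<le> norm (block_vec w v) * norm (block_vec w x)"
    by (rule norm_cauchy_schwarz)
  also have "\<dots> = (norm v)\<^sup>2 * (norm w)\<^sup>2 * (norm x)\<^sup>2"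
    by (simp add: block_vec_norm power2_eq_square mult_ac)
  finally show ?thesis
    unfolding block_vec_inner row_weight_def distinct_weight_def by linarith
qed

end
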